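(* Let $d\ge 4$ and $L\in\{2,3,\ldots\}$. Let $\mathcal{S}_L$ be the strip, i.e. the graph with vertex set $\{0,1,\ldots,L-1\}\times\mathbb{Z}^{d-1}$, nearest-neighbour edges $\{x,y\}$ with $\|x-y\|=1$, and all conductances equal to one, and let $G_{\mathcal{S}_L}$ be the Green's function of the random walk on $\mathcal{S}_L$. Let $g$ be the Green's function of the simple random walk on $\mathbb{Z}^d$. For $y=(y_1,y_2,\ldots,y_d)\in\mathbb{Z}^d$ write $\overline{y}:=(-y_1,y_2,\ldots,y_d)$, and let $\mathbf{e}_{(1)}$ be the first canonical basis vector of $\mathbb{R}^d$. Then for all $x,y\in\{0,1,\ldots,L-1\}\times\mathbb{Z}^{d-1}$, \[ G_{\mathcal{S}_L}(x,y)=\sum_{k=-\infty}^{+\infty}\left[g\left(x,(kL+L-1)\mathbf{e}_{(1)}+\overline{y}\right)\mathbf{1}_{\{k\in 2\mathbb{Z}+1\}}+g\left(x,kL\,\mathbf{e}_{(1)}+y\right)\mathbf{1}_{\{k\in 2\mathbb{Z}\}}\right]. \]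
   Context: Let $\mathcal{G}=(V,E)$ be a connected graph of bounded degree in which each edge $\{x,y\}\in E$ carries a positive finite conductance $c_{\mathcal{G}}(x,y)$; write $x\sim y$ if $\{x,y\}\in E$, and $\pi_{\mathcal{G}}(x):=\sum_{y\sim x}c_{\mathcal{G}}(x,y)$. The random walk $(S_n)_{n\ge 0}$ on $\mathcal{G}$ is the discrete-time Markov chain with transition probabilities $\mathsf{P}(S_{n+1}=y\mid S_n=x)=c_{\mathcal{G}}(x,y)/\pi_{\mathcal{G}}(x)$ for $y\sim x$. When this walk is transient its (normalized) Green's function is \[ G_{\mathcal{G}}(x,y)=\frac{1}{\pi_{\mathcal{G}}(y)}\,\mathsf{E}_x\Big[\sum_{m\ge 0}\mathbf{1}_{\{S_m=y\}}\Big],\qquad x,y\in V, \] where $\mathsf{E}_x$ is the expectation for the walk started at $x$. There is no killing on the boundary of the graph. With unit conductances $\pi_{\mathcal{G}}(x)=\deg(x)$. $g(x,y)$ denotes the Green's function in this sense of the graph with vertex set $\mathbb{Z}^d$, edge set $\{\{x,y\}:\|x-y\|=1\}$ ($\|\cdot\|$ Euclidean norm) and unit conductances; thus $g(x,y)=\frac{1}{2d}\mathsf{E}_x[\sum_{m\ge 0}\mathbf{1}_{\{S_m=y\}}]$ for the simple random walk $S$ on $\mathbb{Z}^d$. *)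

theory Defs
  imports "HOL-Probability.Probability"
begin

section \<open>Random walk on a graph with conductances\<close>

text \<open>
  A graph is given by its set \<open>E\<close> of edges (two-element sets of vertices), and the conductances by a
  function \<open>c\<close> on edges. The vertices of the graphs below are exactly those lying on some edge.
\<close>

definition vertex_weight :: "'v set set \<Rightarrow> ('v set \<Rightarrow> real) \<Rightarrow> 'v \<Rightarrow> real" where
  "vertex_weight E c x = (\<Sum>y | {x, y} \<in> E. c {x, y})"

definition step_pmf :: "'v set set \<Rightarrow> ('v set \<Rightarrow> real) \<Rightarrow> 'v \<Rightarrow> 'v pmf" where
  "step_pmf E c x = embed_pmf (\<lambda>y. if {x, y} \<in> E then c {x, y} / vertex_weight E c x else 0)"

lemma pmf_step_pmf:
  assumes fin: "finite {y. {x, y} \<in> E}" and ne: "\<exists>y. {x, y} \<in> E"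
    and pos: "\<And>e. e \<in> E \<Longrightarrow> 0 < c e"
  shows "pmf (step_pmf E c x) y = (if {x, y} \<in> E then c {x, y} / vertex_weight E c x else 0)"
proof -
  have wpos: "0 < vertex_weight E c x"
    unfolding vertex_weight_def using fin ne pos by (intro sum_pos) auto
  let ?f = "\<lambda>y. if {x, y} \<in> E then c {x, y} / vertex_weight E c x else 0"
  have nonneg: "0 \<le> ?f y" for y
    using pos[of "{x, y}"] wpos by (simp add: less_imp_le)
  have "(\<integral>\<^sup>+y. ennreal (?f y) \<partial>count_space UNIV) = (\<Sum>y | {x, y} \<in> E. ennreal (?f y))"
    by (rule nn_integral_count_space'[OF fin]) auto
  also have "\<dots> = ennreal (\<Sum>y | {x, y} \<in> E. ?f y)"
    using nonneg by (intro sum_ennreal)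
  also have "(\<Sum>y | {x, y} \<in> E. ?f y) = (\<Sum>y | {x, y} \<in> E. c {x, y} / vertex_weight E c x)"
    by (intro sum.cong) auto
  also have "\<dots> = 1"
    using wpos by (simp add: sum_divide_distrib[symmetric] vertex_weight_def)
  finally show ?thesis
    unfolding step_pmf_def using nonneg by (subst pmf_embed_pmf) auto
qed

text \<open>
  The law on trajectories \<open>\<omega> :: nat \<Rightarrow> 'v\<close> of the walk started at \<open>x\<close>, obtained from
  the Ionescu-Tulcea theorem: \<open>\<omega> 0 = x\<close>, and given \<open>\<omega> 0, \<dots>, \<omega> n\<close> the position \<open>\<omega> (n + 1)\<close> has law
  \<open>step_pmf E c (\<omega> n)\<close>; see \<open>walk_cylinder\<close>.
\<close>

definition walk_kernel ::
  "'v set set \<Rightarrow> ('v set \<Rightarrow> real) \<Rightarrow> 'v \<Rightarrow> nat \<Rightarrow> (nat \<Rightarrow> 'v) \<Rightarrow> 'v measure" where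
  "walk_kernel E c x n \<omega> =
     (case n of 0 \<Rightarrow> measure_pmf (return_pmf x) | Suc m \<Rightarrow> measure_pmf (step_pmf E c (\<omega> m)))"

definition walk :: "'v set set \<Rightarrow> ('v set \<Rightarrow> real) \<Rightarrow> 'v \<Rightarrow> (nat \<Rightarrow> 'v) measure" where
  "walk E c x = projective_family.lim UNIV
     (Ionescu_Tulcea.CI (walk_kernel E c x) (\<lambda>_. count_space UNIV)) (\<lambda>_. count_space UNIV)"

lemma Ionescu_Tulcea_walk: "Ionescu_Tulcea (walk_kernel E c x) (\<lambda>_. count_space UNIV)"
proof (rule Ionescu_Tulcea.intro)
  fix n
  show "walk_kernel E c x n \<in>
      measurable (PiM {0..<n} (\<lambda>_. count_space UNIV)) (subprob_algebra (count_space UNIV))"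
  proof (cases n)
    case 0
    have "walk_kernel E c x 0 = (\<lambda>_. measure_pmf (return_pmf x))"
      by (simp add: walk_kernel_def fun_eq_iff)
    then show ?thesis
      unfolding 0 by (auto simp: space_subprob_algebra measure_pmf.subprob_space_axioms
          intro!: measurable_const)
  next
    case (Suc m)
    have "(\<lambda>\<omega>. measure_pmf (step_pmf E c (\<omega> m))) \<in>
        measurable (PiM {0..<Suc m} (\<lambda>_. count_space UNIV)) (subprob_algebra (count_space UNIV))"
      by (rule measurable_compose[where N = "count_space UNIV"])
        (auto simp: space_subprob_algebra measure_pmf.subprob_space_axioms
          intro!: measurable_component_singleton)
    then show ?thesis
      unfolding Suc walk_kernel_def by simp
  qed
next
  fix n \<omega>
  show "prob_space (walk_kernel E c x n \<omega>)"
    by (cases n) (simp_all add: walk_kernel_def measure_pmf.prob_space_axioms)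
qed

lemma sets_walk: "sets (walk E c x) = sets (PiM UNIV (\<lambda>_. count_space UNIV))"
proof -
  interpret Ionescu_Tulcea "walk_kernel E c x" "\<lambda>_. count_space UNIV"
    by (rule Ionescu_Tulcea_walk)
  show ?thesis
    unfolding walk_def by simp
qed

lemma prob_space_walk: "prob_space (walk E c x)"
proof -
  interpret Ionescu_Tulcea "walk_kernel E c x" "\<lambda>_. count_space UNIV"
    by (rule Ionescu_Tulcea_walk)
  have "emeasure PF.lim (PF.emb UNIV {} (space (PiM {} (\<lambda>_. count_space UNIV)))) = 1"
    using prob_space.emeasure_space_1[OF PF.prob_space_P[of "{}"]]
    by (subst lim) (auto simp: PF.space_P)
  moreover have "PF.emb UNIV {} (space (PiM {} (\<lambda>_. count_space UNIV))) = space PF.lim"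
    by (auto simp: prod_emb_def space_PiM restrict_def)
  ultimately show ?thesis
    unfolding walk_def by (intro prob_spaceI) simp
qed

lemma walk_cylinder:
  "emeasure (walk E c x) {\<omega>. \<forall>i\<le>n. \<omega> i = v i} =
     indicator {x} (v 0) * (\<Prod>i<n. ennreal (pmf (step_pmf E c (v i)) (v (Suc i))))"
proof -
  let ?M = "\<lambda>_::nat. count_space (UNIV :: 'a set)"
  interpret Ionescu_Tulcea "walk_kernel E c x" ?M
    by (rule Ionescu_Tulcea_walk)
  let ?v = "\<lambda>n. PiE {0..<Suc n} (\<lambda>i. {v i})"
  have meas: "?v n \<in> sets (PiM {0..<Suc n} ?M)" for n
    by (intro sets_PiM_I_finite) auto
  have C: "emeasure (C 0 (Suc n) (\<lambda>_. undefined)) (?v n) =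
      indicator {x} (v 0) * (\<Prod>i<n. ennreal (pmf (step_pmf E c (v i)) (v (Suc i))))"
  proof (induction n)
    case 0
    have und: "(\<lambda>_. undefined) \<in> space (PiM {0..<0} ?M)"
      by (simp add: space_PiM)
    have "emeasure (C 0 (Suc 0) (\<lambda>_. undefined)) (?v 0) = emeasure (eP 0 (\<lambda>_. undefined)) (?v 0)"
      unfolding C.simps add_0 by (subst bind_return[OF measurable_eP und]) simp
    also have "\<dots> = emeasure (walk_kernel E c x 0 (\<lambda>_. undefined))
        (fun_upd (\<lambda>_. undefined) 0 -` ?v 0 \<inter> space (count_space UNIV))"
      by (rule emeasure_eP[OF und meas])
    also have "fun_upd (\<lambda>_. undefined) 0 -` ?v 0 \<inter> space (count_space UNIV) = {v 0}"
      by (rule set_eqI) (simp add: PiE_iff extensional_def)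
    also have "emeasure (walk_kernel E c x 0 (\<lambda>_. undefined)) {v 0} = indicator {x} (v 0)"
      by (simp add: walk_kernel_def emeasure_pmf_single indicator_def)
    finally show ?case by simp
  next
    case (Suc n)
    let ?C = "C 0 (Suc n) (\<lambda>_. undefined)" and ?p = "pmf (step_pmf E c (v n)) (v (Suc n))"
    have und: "(\<lambda>_. undefined) \<in> space (PiM {0..<0} ?M)"
      by (simp add: space_PiM)
    have sp: "space ?C = space (PiM {0..<Suc n} ?M)"
      using space_C[OF und, of "Suc n"] by (simp del: C.simps)
    have st: "sets ?C = sets (PiM {0..<Suc n} ?M)"
      using sets_C[OF und, of "Suc n"] by (simp del: C.simps)
    have eP: "eP (Suc n) \<in> measurable ?C (subprob_algebra (PiM {0..<Suc (Suc n)} ?M))"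
      using measurable_eP[of "Suc n"] by (simp add: measurable_cong_sets[OF st refl] del: C.simps)
    have "emeasure (C 0 (Suc (Suc n)) (\<lambda>_. undefined)) (?v (Suc n)) =
        (\<integral>\<^sup>+\<omega>. emeasure (eP (Suc n) \<omega>) (?v (Suc n)) \<partial>?C)"
      unfolding C.simps(2)[of 0 "Suc n"] add_0
      by (rule emeasure_bind[OF _ eP meas]) (simp add: sp del: C.simps)
    also have "\<dots> = (\<integral>\<^sup>+\<omega>. ennreal ?p * indicator (?v n) \<omega> \<partial>?C)"
    proof (rule nn_integral_cong)
      fix \<omega> assume "\<omega> \<in> space ?C"
      then have \<omega>: "\<omega> \<in> space (PiM {0..<Suc n} ?M)"
        using sp by simp
      have "emeasure (eP (Suc n) \<omega>) (?v (Suc n)) = emeasure (walk_kernel E c x (Suc n) \<omega>)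
          (fun_upd \<omega> (Suc n) -` ?v (Suc n) \<inter> space (count_space UNIV))"
        by (rule emeasure_eP[OF \<omega> meas])
      also have "fun_upd \<omega> (Suc n) -` ?v (Suc n) \<inter> space (count_space UNIV) =
          (if \<omega> \<in> ?v n then {v (Suc n)} else {})"
      proof -
        have ext: "\<omega> \<in> extensional {0..<Suc n}"
          using \<omega> by (simp add: space_PiM PiE_iff)
        then have "fun_upd \<omega> (Suc n) y \<in> extensional {0..<Suc (Suc n)}" for y
          by (simp add: extensional_def)
        moreover have "(\<forall>i\<in>{0..<Suc (Suc n)}. fun_upd \<omega> (Suc n) y i = v i) \<longleftrightarrow>
            (\<forall>i\<in>{0..<Suc n}. \<omega> i = v i) \<and> y = v (Suc n)" for y
          unfolding atLeastLessThanSuc[of 0 "Suc n"] by auto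
        ultimately show ?thesis
          using ext unfolding PiE_iff vimage_def by auto
      qed
      also have "emeasure (walk_kernel E c x (Suc n) \<omega>) \<dots> = ennreal ?p * indicator (?v n) \<omega>"
      proof (cases "\<omega> \<in> ?v n")
        case True
        then have "\<omega> n = v n"
          by (simp add: PiE_iff)
        with True show ?thesis
          by (simp add: walk_kernel_def emeasure_pmf_single)
      qed simp
      finally show "emeasure (eP (Suc n) \<omega>) (?v (Suc n)) = ennreal ?p * indicator (?v n) \<omega>" .
    qed
    also have "\<dots> = ennreal ?p * emeasure ?C (?v n)"
      using meas[of n] st by (intro nn_integral_cmult_indicator) (simp del: C.simps)
    finally show ?case
      unfolding Suc.IH by (simp add: mult_ac)
  qed
  have "{\<omega>. \<forall>i\<le>n. \<omega> i = v i} = PF.emb UNIV {0..<Suc n} (?v n)"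
    by (auto simp: prod_emb_def space_PiM PiE_iff less_Suc_eq_le)
  then have "emeasure (walk E c x) {\<omega>. \<forall>i\<le>n. \<omega> i = v i} = emeasure (CI {0..<Suc n}) (?v n)"
    unfolding walk_def using lim[OF _ meas[of n]] by simp
  also have "\<dots> = emeasure (C 0 (Suc n) (\<lambda>_. undefined)) (?v n)"
    using emeasure_CI[OF order_refl meas[of n]] meas[of n]
    by (simp add: prod_emb_id[OF sets.sets_into_space[OF meas[of n], unfolded space_PiM]]
        del: C.simps)
  finally show ?thesis
    using C by simp
qed

text \<open>
  Taken with values in \<open>[0, \<infinity>]\<close>, so that the formula makes sense before transience is known.
\<close>

definition green :: "'v set set \<Rightarrow> ('v set \<Rightarrow> real) \<Rightarrow> 'v \<Rightarrow> 'v \<Rightarrow> ennreal" where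
  "green E c x y =
     (\<integral>\<^sup>+\<omega>. (\<Sum>m. indicator {y} (\<omega> m)) \<partial>walk E c x) / ennreal (vertex_weight E c y)"

section \<open>The lattice and the strip\<close>

text \<open>
  \<open>\<int>\<^sup>d\<close> is the type \<open>int ^ 'd\<close> with \<open>d = CARD('d)\<close>. The index type carries no order, so an index
  \<open>i\<close> is singled out to play the role of the first coordinate.
\<close>

definition unit_edges :: "(int ^ 'd) set \<Rightarrow> (int ^ 'd) set set" where
  "unit_edges V =
     {{x, y} | x y. x \<in> V \<and> y \<in> V \<and> norm ((\<chi> j. real_of_int (x $ j - y $ j)) :: real ^ 'd) = 1}"

definition strip :: "nat \<Rightarrow> 'd \<Rightarrow> (int ^ 'd) set" where
  "strip L i = {x. x $ i \<in> {0..int L - 1}}"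

definition lattice_green :: "int ^ 'd \<Rightarrow> int ^ 'd \<Rightarrow> ennreal" where
  "lattice_green = green (unit_edges UNIV) (\<lambda>_. 1)"

definition strip_green :: "nat \<Rightarrow> 'd \<Rightarrow> int ^ 'd \<Rightarrow> int ^ 'd \<Rightarrow> ennreal" where
  "strip_green L i = green (unit_edges (strip L i)) (\<lambda>_. 1)"

definition reflect :: "'d \<Rightarrow> int ^ 'd \<Rightarrow> int ^ 'd" where
  "reflect i y = (\<chi> j. if j = i then - (y $ j) else y $ j)"

end

theory Submission
  imports Defs
begin

text \<open>
  Reflecting in the hyperplanes \<open>x\<^sub>1 = -1/2\<close> and \<open>x\<^sub>1 = L - 1/2\<close> and their translates folds \<open>\<int>\<^sup>d\<close> onto the
  strip. The fold of simple random walk is the walk on the strip with a loop added at each end of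
  every transversal segment: a step that would leave the strip becomes a holding step. Loops prolong
  the visits to a vertex and raise its weight by the same factor, so they leave the normalized Green's
  function unchanged. The fold visits \<open>y\<close> exactly when the walk on \<open>\<int>\<^sup>d\<close> visits one of the images of
  \<open>y\<close>, and these are the points in the sum.

  The folded walk is never constructed. A Green's function with values in \<open>[0, \<infinity>]\<close> is the least
  nonnegative solution of its Poisson equation (\<open>green_set_poisson\<close>, \<open>green_set_least\<close>), and this
  characterization is used in both directions. Let \<open>H\<close> be the sum over the images and \<open>S\<close> the Green's
  function of the strip, both as functions of the starting point. Adding loop terms to both sides of
  the equation for \<open>S\<close> shows that \<open>S\<close> composed with the fold solves the equation for \<open>H\<close>, so \<open>H \<le> S\<close>
  on the strip (\<open>green_images_le_strip\<close>). Conversely \<open>H\<close> is invariant under the reflections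
  (\<open>green_images_reflect\<close>), so its equation at a point of the strip is the one for \<open>S\<close> with loop terms
  added to both sides; if \<open>H\<close> is finite they cancel, and \<open>S \<le> H\<close> (\<open>green_strip_le_images\<close>).

  Finiteness of \<open>S\<close>, hence of \<open>H\<close>, is transience of the strip. It follows from the same minimality:
  in \<open>m = d - 1 \<ge> 3\<close> unbounded directions, a small negative power of a shifted squared distance
  that ignores the first coordinate is superharmonic on the strip, strictly so at \<open>y\<close>
  (\<open>lyapunov_superharmonic\<close>), and a multiple of it therefore dominates \<open>S\<close>
  (\<open>green_set_strip_finite\<close>).
\<close>

section \<open>Green's functions as least supersolutions\<close>

primrec walk_pmf :: "'v set set \<Rightarrow> ('v set \<Rightarrow> real) \<Rightarrow> nat \<Rightarrow> 'v \<Rightarrow> 'v pmf" where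
  "walk_pmf E c 0 x = return_pmf x"
| "walk_pmf E c (Suc n) x = bind_pmf (walk_pmf E c n x) (step_pmf E c)"

lemma walk_pmf_Suc_first:
  "walk_pmf E c (Suc n) x = bind_pmf (step_pmf E c x) (walk_pmf E c n)"
proof (induction n)
  case 0
  show ?case
    by (simp add: bind_return_pmf bind_return_pmf')
next
  case (Suc n)
  have "walk_pmf E c (Suc n) = (\<lambda>z. bind_pmf (walk_pmf E c n z) (step_pmf E c))"
    by (simp add: fun_eq_iff)
  then show ?case
    by (subst walk_pmf.simps(2), subst Suc.IH) (simp add: bind_assoc_pmf)
qed

text \<open>
  The trajectory space is built coordinate by coordinate, and the coordinate added last has, given the
  earlier ones, the law \<open>step_pmf E c\<close> of the previous position; so the law of the position evolves by
  composition with the step.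
\<close>

lemma emeasure_walk_position:
  "emeasure (walk E c x) {\<omega>. \<omega> n \<in> A} = emeasure (walk_pmf E c n x) A"
proof -
  let ?M = "\<lambda>_::nat. count_space (UNIV :: 'a set)"
  interpret Ionescu_Tulcea "walk_kernel E c x" ?M
    by (rule Ionescu_Tulcea_walk)
  define D where "D n = C 0 (Suc n) (\<lambda>_. undefined)" for n
  let ?P = "\<lambda>n. PiM {0..<Suc n} ?M"
  have und: "(\<lambda>_. undefined) \<in> space (PiM {0..<0} ?M)"
    by (simp add: space_PiM)
  have sp: "space (D n) = space (?P n)" for n
    using space_C[OF und, of "Suc n"] by (simp add: D_def del: C.simps)
  have st: "sets (D n) = sets (?P n)" for n
    using sets_C[OF und, of "Suc n"] by (simp add: D_def del: C.simps)
  have comp: "(\<lambda>\<omega>. \<omega> n) \<in> measurable (?P n) (count_space UNIV)" for n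
    by (rule measurable_component_singleton) simp
  have compD: "(\<lambda>\<omega>. \<omega> n) \<in> measurable (D n) (count_space UNIV)" for n
    using comp by (simp add: measurable_cong_sets[OF st refl])
  let ?B = "\<lambda>n A. {\<omega> \<in> space (?P n). \<omega> n \<in> A}"
  have B: "?B n A \<in> sets (?P n)" for n A
    using measurable_sets[OF comp, of A n] by (simp add: vimage_def Int_def conj_commute)
  have distr: "distr (D n) (count_space UNIV) (\<lambda>\<omega>. \<omega> n) = measure_pmf (walk_pmf E c n x)" for n
  proof (induction n)
    case 0
    show ?case
    proof (rule measure_eqI)
      fix A :: "'a set"
      have "emeasure (distr (D 0) (count_space UNIV) (\<lambda>\<omega>. \<omega> 0)) A = emeasure (D 0) (?B 0 A)"
        by (subst emeasure_distr[OF compD]) (auto simp: sp intro!: arg_cong2[where f = emeasure])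
      also have "\<dots> = emeasure (eP 0 (\<lambda>_. undefined)) (?B 0 A)"
        unfolding D_def C.simps add_0 by (subst bind_return[OF measurable_eP und]) simp
      also have "\<dots> = emeasure (walk_kernel E c x 0 (\<lambda>_. undefined))
          (fun_upd (\<lambda>_. undefined) 0 -` ?B 0 A \<inter> space (count_space UNIV))"
        by (rule emeasure_eP[OF und B])
      also have "fun_upd (\<lambda>_. undefined) 0 -` ?B 0 A \<inter> space (count_space UNIV) = A"
        by (rule set_eqI) (simp add: space_PiM PiE_iff extensional_def)
      also have "emeasure (walk_kernel E c x 0 (\<lambda>_. undefined)) A = emeasure (walk_pmf E c 0 x) A"
        by (simp add: walk_kernel_def)
      finally show "emeasure (distr (D 0) (count_space UNIV) (\<lambda>\<omega>. \<omega> 0)) A =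
          emeasure (walk_pmf E c 0 x) A" .
    qed simp
  next
    case (Suc n)
    show ?case
    proof (rule measure_eqI)
      fix A :: "'a set"
      have eP: "eP (Suc n) \<in> measurable (D n) (subprob_algebra (?P (Suc n)))"
        using measurable_eP[of "Suc n"] by (simp add: measurable_cong_sets[OF st refl])
      have "emeasure (distr (D (Suc n)) (count_space UNIV) (\<lambda>\<omega>. \<omega> (Suc n))) A =
          emeasure (D (Suc n)) (?B (Suc n) A)"
        by (subst emeasure_distr[OF compD]) (auto simp: sp intro!: arg_cong2[where f = emeasure])
      also have "\<dots> = (\<integral>\<^sup>+\<omega>. emeasure (eP (Suc n) \<omega>) (?B (Suc n) A) \<partial>D n)"
        unfolding D_def C.simps(2)[of 0 "Suc n"] add_0
        by (rule emeasure_bind[OF _ eP[unfolded D_def] B]) (simp add: sp[unfolded D_def] del: C.simps)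
      also have "\<dots> = (\<integral>\<^sup>+\<omega>. emeasure (step_pmf E c (\<omega> n)) A \<partial>D n)"
      proof (rule nn_integral_cong)
        fix \<omega> assume "\<omega> \<in> space (D n)"
        then have \<omega>: "\<omega> \<in> space (?P n)"
          using sp by simp
        have "emeasure (eP (Suc n) \<omega>) (?B (Suc n) A) = emeasure (walk_kernel E c x (Suc n) \<omega>)
            (fun_upd \<omega> (Suc n) -` ?B (Suc n) A \<inter> space (count_space UNIV))"
          by (rule emeasure_eP[OF \<omega> B])
        also have "fun_upd \<omega> (Suc n) -` ?B (Suc n) A \<inter> space (count_space UNIV) = A"
          using \<omega> by (intro set_eqI) (auto simp: space_PiM PiE_iff extensional_def)
        also have "emeasure (walk_kernel E c x (Suc n) \<omega>) A = emeasure (step_pmf E c (\<omega> n)) A"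
          by (simp add: walk_kernel_def)
        finally show "emeasure (eP (Suc n) \<omega>) (?B (Suc n) A) = emeasure (step_pmf E c (\<omega> n)) A" .
      qed
      also have "\<dots> = (\<integral>\<^sup>+z. emeasure (step_pmf E c z) A \<partial>distr (D n) (count_space UNIV) (\<lambda>\<omega>. \<omega> n))"
        by (subst nn_integral_distr[OF compD]) auto
      also have "\<dots> = emeasure (walk_pmf E c (Suc n) x) A"
        by (simp add: Suc.IH emeasure_bind_pmf)
      finally show "emeasure (distr (D (Suc n)) (count_space UNIV) (\<lambda>\<omega>. \<omega> (Suc n))) A =
          emeasure (walk_pmf E c (Suc n) x) A" .
    qed simp
  qed
  have "{\<omega>. \<omega> n \<in> A} = PF.emb UNIV {0..<Suc n} (?B n A)"
    by (auto simp: prod_emb_def space_PiM PiE_iff)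
  then have "emeasure (walk E c x) {\<omega>. \<omega> n \<in> A} = emeasure (CI {0..<Suc n}) (?B n A)"
    unfolding walk_def using lim[OF _ B[of n A]] by simp
  also have "\<dots> = emeasure (D n) (?B n A)"
  proof -
    have "?B n A \<subseteq> (\<Pi>\<^sub>E i\<in>{0..<Suc n}. space (?M i))"
      by (auto simp: space_PiM)
    then show ?thesis
      using emeasure_CI[OF order_refl B[of n A]] by (simp add: prod_emb_id D_def del: C.simps)
  qed
  also have "\<dots> = emeasure (distr (D n) (count_space UNIV) (\<lambda>\<omega>. \<omega> n)) A"
    by (subst emeasure_distr[OF compD]) (auto simp: sp intro!: arg_cong2[where f = emeasure])
  finally show ?thesis
    unfolding distr .
qed

text \<open>
  The charge \<open>f\<close> is a general function so that visits to a whole set of points, here all images of one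
  vertex, are covered as well.
\<close>

definition potential ::
  "'v set set \<Rightarrow> ('v set \<Rightarrow> real) \<Rightarrow> ('v \<Rightarrow> ennreal) \<Rightarrow> 'v \<Rightarrow> ennreal" where
  "potential E c f x = (\<Sum>n. \<integral>\<^sup>+z. f z \<partial>walk_pmf E c n x)"

lemma green_eq_potential:
  "green E c x y = potential E c (indicator {y}) x / ennreal (vertex_weight E c y)"
proof -
  have meas: "(\<lambda>\<omega>. indicator {y} (\<omega> m) :: ennreal) \<in> borel_measurable (walk E c x)" for m
    unfolding measurable_cong_sets[OF sets_walk refl]
    by (rule measurable_compose[OF measurable_component_singleton[of m]]) auto
  have "(\<integral>\<^sup>+\<omega>. (\<Sum>m. indicator {y} (\<omega> m)) \<partial>walk E c x) =
      (\<Sum>m. \<integral>\<^sup>+\<omega>. indicator {y} (\<omega> m) \<partial>walk E c x)"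
    using meas by (rule nn_integral_suminf)
  also have "\<dots> = (\<Sum>m. emeasure (walk E c x) {\<omega>. \<omega> m \<in> {y}})"
  proof (rule suminf_cong)
    fix m
    have sp: "space (walk E c x) = UNIV"
      using sets_eq_imp_space_eq[OF sets_walk[of E c x]] by (simp add: space_PiM)
    have "{\<omega>. \<omega> m \<in> {y}} \<in> sets (walk E c x)"
      using measurable_sets[OF meas[of m], of "{1}"] sp
      by (auto simp: vimage_def indicator_def if_distrib cong: if_cong)
    then have "emeasure (walk E c x) {\<omega>. \<omega> m \<in> {y}} =
        (\<integral>\<^sup>+\<omega>. indicator {\<omega>. \<omega> m \<in> {y}} \<omega> \<partial>walk E c x)"
      by simp
    then show "(\<integral>\<^sup>+\<omega>. indicator {y} (\<omega> m) \<partial>walk E c x) = emeasure (walk E c x) {\<omega>. \<omega> m \<in> {y}}"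
      by (simp add: indicator_def)
  qed
  finally show ?thesis
    by (simp only: green_def emeasure_walk_position potential_def) simp
qed

lemma potential_step:
  "potential E c f x = f x + (\<integral>\<^sup>+z. potential E c f z \<partial>step_pmf E c x)"
proof -
  have "potential E c f x = f x + (\<Sum>n. \<integral>\<^sup>+z. f z \<partial>walk_pmf E c (Suc n) x)"
    unfolding potential_def by (subst suminf_offset[where i = 1]) (auto simp: nn_integral_return_pmf)
  also have "(\<Sum>n. \<integral>\<^sup>+z. f z \<partial>walk_pmf E c (Suc n) x) =
      (\<integral>\<^sup>+z. potential E c f z \<partial>step_pmf E c x)"
    unfolding potential_def walk_pmf_Suc_first nn_integral_bind_pmf
    by (subst nn_integral_suminf) auto
  finally show ?thesis .
qed

text \<open>
  The partial sums over times below \<open>N\<close> obey the recursion \<open>u\<^sub>N\<^sub>+\<^sub>1 = f + P u\<^sub>N\<close> from \<open>u\<^sub>0 = 0\<close>, so every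
  supersolution with values in \<open>[0, \<infinity>]\<close> stays above them.
\<close>

lemma potential_least:
  assumes closed: "\<And>x. x \<in> V \<Longrightarrow> set_pmf (step_pmf E c x) \<subseteq> V"
    and super: "\<And>x. x \<in> V \<Longrightarrow> f x + (\<integral>\<^sup>+z. u z \<partial>step_pmf E c x) \<le> u x"
    and "x \<in> V"
  shows "potential E c f x \<le> u x"
proof -
  have "(\<Sum>n<N. \<integral>\<^sup>+z. f z \<partial>walk_pmf E c n x) \<le> u x" if "x \<in> V" for N x
    using that
  proof (induction N arbitrary: x)
    case (Suc N)
    have "(\<Sum>n<Suc N. \<integral>\<^sup>+z. f z \<partial>walk_pmf E c n x) =
        f x + (\<integral>\<^sup>+z. (\<Sum>n<N. \<integral>\<^sup>+w. f w \<partial>walk_pmf E c n z) \<partial>step_pmf E c x)"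
      unfolding sum.lessThan_Suc_shift walk_pmf_Suc_first nn_integral_bind_pmf
      by (subst nn_integral_sum) auto
    also have "\<dots> \<le> f x + (\<integral>\<^sup>+z. u z \<partial>step_pmf E c x)"
      using closed[OF Suc.prems] Suc.IH
      by (intro add_left_mono nn_integral_mono_AE) (auto simp: AE_measure_pmf_iff)
    also have "\<dots> \<le> u x"
      by (rule super[OF Suc.prems])
    finally show ?case .
  qed simp
  then show ?thesis
    unfolding potential_def using \<open>x \<in> V\<close>
    by (intro suminf_le_const[OF summableI]) auto
qed

lemma potential_cmult:
  "potential E c (\<lambda>z. a * f z) x = a * potential E c f x"
  unfolding potential_def by (simp add: nn_integral_cmult)

lemma step_pmf_facts:
  assumes fin: "finite {y. {x, y} \<in> E}" and ne: "\<exists>y. {x, y} \<in> E"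
    and pos: "\<And>e. e \<in> E \<Longrightarrow> 0 < c e"
  shows vertex_weight_pos: "0 < vertex_weight E c x"
    and set_step_pmf: "set_pmf (step_pmf E c x) = {y. {x, y} \<in> E}"
    and nn_integral_step_pmf: "ennreal (vertex_weight E c x) * (\<integral>\<^sup>+z. u z \<partial>step_pmf E c x) =
      (\<Sum>y | {x, y} \<in> E. ennreal (c {x, y}) * u y)"
proof -
  note p = pmf_step_pmf[OF fin ne pos]
  show w: "0 < vertex_weight E c x"
    unfolding vertex_weight_def using fin ne pos by (intro sum_pos) auto
  show s: "set_pmf (step_pmf E c x) = {y. {x, y} \<in> E}"
    using w by (auto simp: set_pmf_eq p dest: pos)
  have "(\<integral>\<^sup>+z. u z \<partial>step_pmf E c x) = (\<Sum>y | {x, y} \<in> E. u y * ennreal (c {x, y} / vertex_weight E c x))"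
    using fin by (subst nn_integral_measure_pmf_finite) (auto simp: s p)
  then have "ennreal (vertex_weight E c x) * (\<integral>\<^sup>+z. u z \<partial>step_pmf E c x) =
      (\<Sum>y | {x, y} \<in> E.
        u y * (ennreal (vertex_weight E c x) * ennreal (c {x, y} / vertex_weight E c x)))"
    by (simp add: sum_distrib_left mult_ac)
  also have "\<dots> = (\<Sum>y | {x, y} \<in> E. ennreal (c {x, y}) * u y)"
    using w by (intro sum.cong) (auto simp: ennreal_mult'[symmetric] mult.commute)
  finally show "ennreal (vertex_weight E c x) * (\<integral>\<^sup>+z. u z \<partial>step_pmf E c x) =
      (\<Sum>y | {x, y} \<in> E. ennreal (c {x, y}) * u y)" .
qed

lemma infsum_ennreal_int:
  fixes f :: "int \<Rightarrow> ennreal"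
  shows "infsum f UNIV = (\<integral>\<^sup>+k. f k \<partial>count_space UNIV)"
proof -
  have "infsum f UNIV = infsum (\<lambda>n. f (int_decode n)) UNIV"
    by (rule infsum_reindex_bij_betw[OF bij_int_decode, symmetric])
  also have "\<dots> = (\<Sum>n. f (int_decode n))"
    by (intro sums_unique has_sum_imp_sums has_sum_infsum nonneg_summable_on_complete) simp
  also have "\<dots> = (\<integral>\<^sup>+k. f k \<partial>count_space UNIV)"
    unfolding nn_integral_count_space_nat[symmetric]
    by (rule nn_integral_bij_count_space[OF bij_int_decode])
  finally show ?thesis .
qed

section \<open>Walks in subsets of the lattice\<close>

text \<open>
  A neighbour of \<open>x\<close> is written \<open>x + e\<close> with \<open>e\<close> a unit vector. This makes the neighbourhoods of
  different points comparable, and a reflection acts on them by permuting the unit vectors.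
\<close>

definition unit_vecs :: "(int ^ 'd::finite) set" where
  "unit_vecs = (\<lambda>(j, s). axis j s) ` (UNIV \<times> {1, -1})"

lemma finite_unit_vecs [simp]: "finite unit_vecs"
  by (simp add: unit_vecs_def)

lemma inj_on_signed_axis: "inj_on (\<lambda>(j, s). axis j s :: int ^ 'd::finite) (UNIV \<times> {1, -1})"
  by (auto simp: inj_on_def axis_eq_axis)

lemma norm_eq_1_iff_unit_vec:
  fixes v :: "int ^ 'd::finite"
  shows "norm ((\<chi> j. real_of_int (v $ j)) :: real ^ 'd) = 1 \<longleftrightarrow> v \<in> unit_vecs"
proof -
  have "norm ((\<chi> j. real_of_int (v $ j)) :: real ^ 'd) = sqrt (\<Sum>j\<in>UNIV. (real_of_int (v $ j))\<^sup>2)"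
    by (simp add: norm_vec_def L2_set_def)
  also have "\<dots> = sqrt (real_of_int (\<Sum>j\<in>UNIV. (v $ j)\<^sup>2))"
    by simp
  finally have norm: "norm ((\<chi> j. real_of_int (v $ j)) :: real ^ 'd) = 1 \<longleftrightarrow> (\<Sum>j\<in>UNIV. (v $ j)\<^sup>2) = 1"
    by (metis of_int_1 of_int_eq_iff real_sqrt_eq_1_iff)
  show ?thesis
    unfolding norm
  proof
    assume sum: "(\<Sum>j\<in>UNIV. (v $ j)\<^sup>2) = 1"
    then obtain j where j: "v $ j \<noteq> 0"
      by (force intro: ccontr)
    have split: "(v $ j)\<^sup>2 + (\<Sum>k\<in>UNIV - {j}. (v $ k)\<^sup>2) = 1"
      using sum by (simp add: sum.remove[where x = j])
    have nonneg: "0 \<le> (\<Sum>k\<in>UNIV - {j}. (v $ k)\<^sup>2)"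
      by (intro sum_nonneg) simp
    have "1 \<le> (v $ j)\<^sup>2"
      using j by (metis int_one_le_iff_zero_less zero_less_power2)
    with split nonneg have one: "(v $ j)\<^sup>2 = 1" and "(\<Sum>k\<in>UNIV - {j}. (v $ k)\<^sup>2) = 0"
      by linarith+
    then have "v $ k = 0" if "k \<noteq> j" for k
      using that by (simp add: sum_nonneg_eq_0_iff)
    then have "v = axis j (v $ j)"
      by (simp add: vec_eq_iff axis_def)
    moreover have "v $ j \<in> {1, -1}"
      using one by (simp add: power2_eq_1_iff)
    ultimately show "v \<in> unit_vecs"
      unfolding unit_vecs_def by (intro image_eqI[of _ _ "(j, v $ j)"]) auto
  next
    assume "v \<in> unit_vecs"
    then obtain j s where v: "v = axis j s" and s: "s \<in> {1, -1}"
      by (auto simp: unit_vecs_def)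
    have "(\<Sum>k\<in>UNIV. (v $ k)\<^sup>2) = (\<Sum>k\<in>UNIV. if k = j then s\<^sup>2 else 0)"
      by (intro sum.cong) (auto simp: v axis_def)
    also have "\<dots> = 1"
      using s by auto
    finally show "(\<Sum>k\<in>UNIV. (v $ k)\<^sup>2) = 1" .
  qed
qed

lemma uminus_unit_vec: "- v \<in> unit_vecs \<longleftrightarrow> v \<in> unit_vecs"
proof -
  have "((\<chi> j. real_of_int ((- v) $ j)) :: real ^ 'a) = - (\<chi> j. real_of_int (v $ j))"
    by (simp add: vec_eq_iff)
  then show ?thesis
    unfolding norm_eq_1_iff_unit_vec[symmetric] by (simp only: norm_minus_cancel)
qed

lemma unit_edge_iff:
  "{x, y} \<in> unit_edges V \<longleftrightarrow> x \<in> V \<and> y \<in> V \<and> y - x \<in> unit_vecs"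
proof -
  have edge: "{x, y} \<in> unit_edges V \<longleftrightarrow>
      (\<exists>u v. {x, y} = {u, v} \<and> u \<in> V \<and> v \<in> V \<and> u - v \<in> unit_vecs)"
    unfolding unit_edges_def norm_eq_1_iff_unit_vec[symmetric] by simp
  show ?thesis
    unfolding edge doubleton_eq_iff using uminus_unit_vec[of "x - y"] uminus_unit_vec[of "y - x"]
    by auto
qed

definition steps_in :: "(int ^ 'd::finite) set \<Rightarrow> int ^ 'd \<Rightarrow> (int ^ 'd) set" where
  "steps_in V x = {e \<in> unit_vecs. x + e \<in> V}"

lemma finite_steps_in [simp]: "finite (steps_in V x)"
  by (simp add: steps_in_def)

lemma neighbours_eq:
  "x \<in> V \<Longrightarrow> {y. {x, y} \<in> unit_edges V} = (+) x ` steps_in V x"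
  by (force simp: unit_edge_iff steps_in_def image_iff intro: bexI[of _ "_ - x"])

abbreviation unit_weight :: "(int ^ 'd::finite) set \<Rightarrow> int ^ 'd \<Rightarrow> real" where
  "unit_weight V \<equiv> vertex_weight (unit_edges V) (\<lambda>_. 1)"

lemma unit_weight_eq: "x \<in> V \<Longrightarrow> unit_weight V x = real (card (steps_in V x))"
  by (simp add: vertex_weight_def neighbours_eq card_image)

text \<open>
  The expected time spent in \<open>F\<close>, each visit being normalized by the weight of the visited vertex. For
  \<open>F = {y}\<close> this is \<open>green\<close>, and it is additive in \<open>F\<close>.
\<close>

definition green_set :: "(int ^ 'd::finite) set \<Rightarrow> (int ^ 'd) set \<Rightarrow> int ^ 'd \<Rightarrow> ennreal" where
  "green_set V F = potential (unit_edges V) (\<lambda>_. 1)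
     (\<lambda>z. indicator F z / ennreal (unit_weight V z))"

lemma green_eq_green_set: "green (unit_edges V) (\<lambda>_. 1) x y = green_set V {y} x"
proof -
  have "(\<lambda>z. indicator {y} z / ennreal (unit_weight V z)) =
      (\<lambda>z. 1 / ennreal (unit_weight V y) * indicator {y} z)"
    by (auto simp: fun_eq_iff split: split_indicator)
  then show ?thesis
    unfolding green_set_def
    by (simp only: green_eq_potential potential_cmult)
      (simp add: divide_ennreal_def mult.commute)
qed

lemma unit_step:
  assumes "x \<in> V" and "steps_in V x \<noteq> {}"
  shows set_pmf_unit_step: "set_pmf (step_pmf (unit_edges V) (\<lambda>_. 1) x) \<subseteq> V"
    and unit_step_equation: "of_nat (card (steps_in V x)) *
        (indicator F x / ennreal (unit_weight V x) +
          (\<integral>\<^sup>+z. u z \<partial>step_pmf (unit_edges V) (\<lambda>_. 1) x)) =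
      indicator F x + (\<Sum>e\<in>steps_in V x. u (x + e))"
proof -
  have fin: "finite {y. {x, y} \<in> unit_edges V}"
    using \<open>x \<in> V\<close> by (simp add: neighbours_eq)
  have ne: "\<exists>y. {x, y} \<in> unit_edges V"
    using neighbours_eq[OF \<open>x \<in> V\<close>] assms(2) by auto
  have pos: "0 < (1::real)" by simp
  show "set_pmf (step_pmf (unit_edges V) (\<lambda>_. 1) x) \<subseteq> V"
    by (subst set_step_pmf[OF fin ne pos]) (auto simp: unit_edge_iff)
  have w: "0 < unit_weight V x"
    by (rule vertex_weight_pos[OF fin ne pos])
  have deg: "of_nat (card (steps_in V x)) = ennreal (unit_weight V x)"
    by (simp add: unit_weight_eq[OF \<open>x \<in> V\<close>] ennreal_of_nat_eq_real_of_nat)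
  have "ennreal (unit_weight V x) * (indicator F x / ennreal (unit_weight V x)) = indicator F x"
    using w by (simp add: ennreal_times_divide mult_divide_eq_ennreal mult.commute[of "ennreal _"])
  moreover have "ennreal (unit_weight V x) * (\<integral>\<^sup>+z. u z \<partial>step_pmf (unit_edges V) (\<lambda>_. 1) x) =
      (\<Sum>e\<in>steps_in V x. u (x + e))"
    by (subst nn_integral_step_pmf[OF fin ne pos])
      (simp add: neighbours_eq[OF \<open>x \<in> V\<close>] sum.reindex)
  ultimately show "of_nat (card (steps_in V x)) *
        (indicator F x / ennreal (unit_weight V x) +
          (\<integral>\<^sup>+z. u z \<partial>step_pmf (unit_edges V) (\<lambda>_. 1) x)) =
      indicator F x + (\<Sum>e\<in>steps_in V x. u (x + e))"
    unfolding deg distrib_left by simp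
qed

text \<open>
  Together with the next lemma this is the form in which Green's functions are compared below: the
  equation is multiplied by the degree, so that no division remains.
\<close>

lemma green_set_poisson:
  assumes "x \<in> V" and "steps_in V x \<noteq> {}"
  shows "of_nat (card (steps_in V x)) * green_set V F x =
    indicator F x + (\<Sum>e\<in>steps_in V x. green_set V F (x + e))"
  unfolding unit_step_equation[OF assms, symmetric]
  by (subst green_set_def, subst potential_step) (simp add: green_set_def)

lemma green_set_least:
  assumes ne: "\<And>x. x \<in> V \<Longrightarrow> steps_in V x \<noteq> {}"
    and super: "\<And>x. x \<in> V \<Longrightarrow>
      indicator F x + (\<Sum>e\<in>steps_in V x. u (x + e)) \<le> of_nat (card (steps_in V x)) * u x"
    and "x \<in> V"
  shows "green_set V F x \<le> u x"
  unfolding green_set_def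
proof (rule potential_least[where V = V, OF set_pmf_unit_step[OF _ ne] _ \<open>x \<in> V\<close>])
  fix x assume x: "x \<in> V"
  let ?n = "of_nat (card (steps_in V x)) :: ennreal"
  have n: "0 < card (steps_in V x)"
    using ne[OF x] by (simp add: card_gt_0_iff)
  have "?n * (indicator F x / ennreal (unit_weight V x) +
        (\<integral>\<^sup>+z. u z \<partial>step_pmf (unit_edges V) (\<lambda>_. 1) x)) \<le> ?n * u x"
    unfolding unit_step_equation[OF x ne[OF x]] by (rule super[OF x])
  then show "indicator F x / ennreal (unit_weight V x) +
        (\<integral>\<^sup>+z. u z \<partial>step_pmf (unit_edges V) (\<lambda>_. 1) x) \<le> u x"
    using n by (subst (asm) ennreal_mult_le_mult_iff) (auto simp: )
qed

text \<open>
  On the whole lattice all weights agree, so additivity over the points of \<open>F\<close> is the interchange of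
  two sums of nonnegative terms. Injectivity of \<open>z\<close> keeps a point from being counted twice.
\<close>

lemma green_set_UNIV_range:
  fixes z :: "int \<Rightarrow> int ^ 'd::finite"
  assumes "inj z"
  shows "(\<Sum>\<^sub>\<infinity>k. lattice_green x (z k)) = green_set UNIV (range z) x"
proof -
  let ?E = "unit_edges (UNIV :: (int ^ 'd) set)" and ?c = "\<lambda>_. 1 :: real"
  define r where "r = 1 / ennreal (real (card (unit_vecs :: (int ^ 'd) set)))"
  have w: "unit_weight UNIV v = real (card (unit_vecs :: (int ^ 'd) set))" for v :: "int ^ 'd"
    by (simp add: unit_weight_eq steps_in_def)
  have pot: "green_set UNIV F x = r * potential ?E ?c (indicator F) x" for F
    unfolding green_set_def potential_cmult[symmetric] w r_def
    by (simp add: divide_ennreal_def mult.commute)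
  have "(\<Sum>\<^sub>\<infinity>k. lattice_green x (z k)) = (\<integral>\<^sup>+k. r * potential ?E ?c (indicator {z k}) x \<partial>count_space UNIV)"
    by (simp add: infsum_ennreal_int lattice_green_def green_eq_green_set pot)
  also have "\<dots> = r * (\<integral>\<^sup>+k. (\<Sum>n. ennreal (pmf (walk_pmf ?E ?c n x) (z k))) \<partial>count_space UNIV)"
    by (simp add: nn_integral_cmult potential_def emeasure_pmf_single)
  also have "\<dots> = r * (\<Sum>n. \<integral>\<^sup>+k. ennreal (pmf (walk_pmf ?E ?c n x) (z k)) \<partial>count_space UNIV)"
    by (subst nn_integral_suminf) auto
  also have "\<dots> = r * potential ?E ?c (indicator (range z)) x"
    by (simp add: nn_integral_pmf'[OF assms] potential_def)
  finally show ?thesis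
    by (simp add: pot)
qed

section \<open>Folding the lattice onto the strip\<close>

text \<open>
  The map by which the fundamental strip is carried onto its \<open>k\<close>-th translate: a translation for even
  \<open>k\<close> and the reflection in the hyperplane at height \<open>(kL + L - 1)/2\<close> for odd \<open>k\<close>.
\<close>

definition image_point :: "nat \<Rightarrow> 'd::finite \<Rightarrow> int \<Rightarrow> int ^ 'd \<Rightarrow> int ^ 'd" where
  "image_point L i k y =
     (if odd k then (k * int L + int L - 1) *s axis i 1 + reflect i y
      else (k * int L) *s axis i 1 + y)"

definition fold_coord :: "nat \<Rightarrow> int \<Rightarrow> int" where
  "fold_coord L a = (if even (a div int L) then a mod int L else int L - 1 - a mod int L)"

definition fold_point :: "nat \<Rightarrow> 'd::finite \<Rightarrow> int ^ 'd \<Rightarrow> int ^ 'd" where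
  "fold_point L i x = (\<chi> j. if j = i then fold_coord L (x $ i) else x $ j)"

lemma image_point_nth:
  "image_point L i k y $ j =
     (if j \<noteq> i then y $ j else if odd k then k * int L + int L - 1 - y $ i else k * int L + y $ i)"
  by (simp add: image_point_def reflect_def axis_def)

lemma image_point_add:
  "image_point L i k (y + e) = image_point L i k y + (if odd k then reflect i e else e)"
  by (simp add: vec_eq_iff image_point_nth reflect_def)

lemma image_point_involution:
  "odd k \<Longrightarrow> image_point L i k (image_point L i k y) = y"
  by (simp add: vec_eq_iff image_point_nth)

context
  fixes L :: nat
  assumes L: "0 < L"
begin

lemma div_mod_image_coord:
  shows "(k * int L + a) div int L = k + a div int L" and "(k * int L + a) mod int L = a mod int L"
    and "(k * int L + int L - 1 - a) div int L = k - a div int L"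
    and "(k * int L + int L - 1 - a) mod int L = int L - 1 - a mod int L"
proof -
  show "(k * int L + a) div int L = k + a div int L" and "(k * int L + a) mod int L = a mod int L"
    using L by simp_all
  have "0 \<le> int L - 1 - a mod int L" and "int L - 1 - a mod int L < int L"
    using L pos_mod_bound[of "int L" a] pos_mod_sign[of "int L" a] by linarith+
  then have "(int L - 1 - a mod int L) div int L = 0"
    and "(int L - 1 - a mod int L) mod int L = int L - 1 - a mod int L"
    by (rule div_pos_pos_trivial, rule mod_pos_pos_trivial)
  moreover have eq: "k * int L + int L - 1 - a = (int L - 1 - a mod int L) + (k - a div int L) * int L"
    using div_mult_mod_eq[of a "int L"] by (simp add: algebra_simps)
  ultimately show "(k * int L + int L - 1 - a) div int L = k - a div int L"
    and "(k * int L + int L - 1 - a) mod int L = int L - 1 - a mod int L"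
    using L unfolding eq by simp_all
qed

lemma fold_point_image_point: "fold_point L i (image_point L i k x) = fold_point L i x"
  by (auto simp: vec_eq_iff fold_point_def image_point_nth fold_coord_def div_mod_image_coord)

text \<open>
  The strips \<open>kL \<le> x\<^sub>i < (k + 1)L\<close> tile the lattice, so the quotient \<open>x\<^sub>i div L\<close> names the map that undoes
  the folding.
\<close>

lemma image_point_fold_point: "image_point L i (x $ i div int L) (fold_point L i x) = x"
proof -
  have "x $ i = x $ i div int L * int L + x $ i mod int L"
    by simp
  then show ?thesis
    by (auto simp: vec_eq_iff fold_point_def image_point_nth fold_coord_def)
qed

lemma fold_point_strip: "fold_point L i x \<in> strip L i"
proof -
  have "0 \<le> x $ i mod int L" and "x $ i mod int L < int L"
    using L by simp_all
  then show ?thesis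
    by (simp add: strip_def fold_point_def fold_coord_def)
qed

lemma fold_point_ident: "x \<in> strip L i \<Longrightarrow> fold_point L i x = x"
  by (auto simp: vec_eq_iff strip_def fold_point_def fold_coord_def div_pos_pos_trivial mod_pos_pos_trivial)

lemma range_image_point:
  assumes "y \<in> strip L i"
  shows "x \<in> range (\<lambda>k. image_point L i k y) \<longleftrightarrow> fold_point L i x = y"
proof
  assume "x \<in> range (\<lambda>k. image_point L i k y)"
  then show "fold_point L i x = y"
    using assms by (auto simp: fold_point_image_point fold_point_ident)
next
  assume "fold_point L i x = y"
  then show "x \<in> range (\<lambda>k. image_point L i k y)"
    using image_point_fold_point[of i x] by (metis rangeI)
qed

lemma inj_image_point:
  assumes "y \<in> strip L i"
  shows "inj (\<lambda>k. image_point L i k y)"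
proof (rule inj_on_inverseI)
  fix k
  have "y $ i div int L = 0"
    using assms by (simp add: strip_def div_pos_pos_trivial)
  then show "image_point L i k y $ i div int L = k"
    by (simp add: image_point_nth div_mod_image_coord)
qed

text \<open>
  The walls sit half a step outside the strip, so a step across one lands on the mirror image of its own
  starting point. This is why reflection corresponds to holding.
\<close>

lemma step_out_of_strip:
  assumes x: "x \<in> strip L i" and e: "e \<in> unit_vecs" and out: "x + e \<notin> strip L i"
  shows "\<exists>k. odd k \<and> x + e = image_point L i k x"
proof -
  obtain j s where e': "e = axis j s" and s: "s = 1 \<or> s = -1"
    using e by (auto simp: unit_vecs_def)
  have j: "j = i"
    using x out by (auto simp: e' strip_def axis_def split: if_splits)
  consider "s = 1" "x $ i = int L - 1" | "s = -1" "x $ i = 0"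
    using x out s by (auto simp: e' j strip_def)
  then show ?thesis
  proof cases
    case 1
    then have "x + e = image_point L i 1 x"
      by (auto simp: e' j vec_eq_iff image_point_nth axis_def)
    then show ?thesis
      by (intro exI[of _ 1]) simp
  next
    case 2
    then have "x + e = image_point L i (-1) x"
      by (auto simp: e' j vec_eq_iff image_point_nth axis_def)
    then show ?thesis
      by (intro exI[of _ "-1"]) simp
  qed
qed

lemma reflect_unit_vec: "e \<in> unit_vecs \<Longrightarrow> reflect i e \<in> unit_vecs"
proof -
  have "(\<Sum>j\<in>UNIV. (real_of_int (reflect i e $ j))\<^sup>2) = (\<Sum>j\<in>UNIV. (real_of_int (e $ j))\<^sup>2)"
    by (intro sum.cong) (auto simp: reflect_def)
  then show "e \<in> unit_vecs \<Longrightarrow> reflect i e \<in> unit_vecs"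
    by (simp add: norm_eq_1_iff_unit_vec[symmetric] norm_vec_def L2_set_def)
qed

text \<open>
  Harmonicity is preserved by the image maps, since each permutes the unit vectors.
\<close>

lemma sum_image_steps:
  "(\<Sum>e\<in>unit_vecs. u (image_point L i k x + e)) = (\<Sum>e\<in>unit_vecs. u (image_point L i k (x + e)))"
  for x :: "int ^ 'd::finite"
proof -
  have inv: "reflect i (reflect i e) = e" for e :: "int ^ 'd"
    by (simp add: vec_eq_iff reflect_def)
  have "(\<Sum>e\<in>unit_vecs. u (image_point L i k x + e)) =
      (\<Sum>e\<in>unit_vecs. u (image_point L i k x + (if odd k then reflect i e else e)))"
    by (rule sum.reindex_bij_witness[of _ "\<lambda>e. if odd k then reflect i e else e"
          "\<lambda>e. if odd k then reflect i e else e"]) (auto simp: inv reflect_unit_vec)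
  then show ?thesis
    by (simp only: image_point_add)
qed

section \<open>The method of images\<close>

lemma sum_unit_vecs_split:
  fixes x :: "int ^ 'd::finite"
  assumes "x \<in> strip L i" and out: "\<And>e. e \<in> unit_vecs \<Longrightarrow> x + e \<notin> strip L i \<Longrightarrow> u (x + e) = u x"
  shows "(\<Sum>e\<in>unit_vecs. u (x + e)) =
      (\<Sum>e\<in>steps_in (strip L i) x. u (x + e)) +
      of_nat (card (unit_vecs - steps_in (strip L i) x)) * (u x :: ennreal)"
proof -
  have sub: "steps_in (strip L i) x \<subseteq> unit_vecs"
    by (auto simp: steps_in_def)
  have "(\<Sum>e\<in>unit_vecs - steps_in (strip L i) x. u (x + e)) =
      (\<Sum>e\<in>unit_vecs - steps_in (strip L i) x. u x)"
    by (intro sum.cong) (auto simp: steps_in_def out)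
  then show ?thesis
    using sum.subset_diff[OF sub, of "\<lambda>e. u (x + e)"] by (simp add: add.commute)
qed

lemma card_unit_vecs_split:
  fixes x :: "int ^ 'd::finite"
  shows "of_nat (card (steps_in V x)) * u + of_nat (card (unit_vecs - steps_in V x)) * u =
    of_nat (card (unit_vecs :: (int ^ 'd) set)) * (u :: ennreal)"
proof -
  have "card (unit_vecs :: (int ^ 'd) set) = card (steps_in V x) + card (unit_vecs - steps_in V x)"
    by (subst card_Un_disjoint[symmetric]) (auto simp: steps_in_def intro!: arg_cong[where f = card])
  then show ?thesis
    by (simp add: distrib_right)
qed

lemma steps_in_UNIV [simp]: "steps_in UNIV x = unit_vecs"
  by (simp add: steps_in_def)

lemma unit_vecs_ne [simp]: "(unit_vecs :: (int ^ 'd::finite) set) \<noteq> {}"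
  by (auto simp: unit_vecs_def)

lemma steps_in_strip_ne:
  fixes x :: "int ^ 'd::finite"
  assumes "2 \<le> CARD('d)" and "x \<in> strip L i"
  shows "steps_in (strip L i) x \<noteq> {}"
proof -
  obtain j where "j \<noteq> i"
    using assms(1) by (metis (full_types) UNIV_I card_2_iff' card_le_Suc0_iff_eq finite not_less_eq_eq numeral_2_eq_2)
  then have "axis j 1 \<in> steps_in (strip L i) x"
    using assms(2) by (auto simp: steps_in_def unit_vecs_def strip_def axis_def image_iff)
  then show ?thesis by blast
qed

text \<open>
  The set of images is invariant under reflection, so the reflected function solves the same equation
  and minimality gives one inequality; the reflection being an involution gives the other.
\<close>

lemma green_images_reflect:
  assumes y: "y \<in> strip L i" and k: "odd k"
  defines "F \<equiv> range (\<lambda>k. image_point L i k y)"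
  shows "green_set UNIV F (image_point L i k x) = green_set UNIV F x"
proof -
  let ?H = "green_set UNIV F"
  have F: "indicator F (image_point L i k v) = (indicator F v :: ennreal)" for v
    unfolding F_def indicator_def range_image_point[OF y] by (simp add: fold_point_image_point)
  have le: "?H v \<le> ?H (image_point L i k v)" for v
  proof (rule green_set_least)
    fix z :: "int ^ 'a"
    show "indicator F z + (\<Sum>e\<in>steps_in UNIV z. ?H (image_point L i k (z + e))) \<le>
        of_nat (card (steps_in UNIV z)) * ?H (image_point L i k z)"
      using green_set_poisson[of "image_point L i k z" UNIV F]
      by (simp add: F sum_image_steps)
  qed simp_all
  show ?thesis
    using le[of x] le[of "image_point L i k x"] by (simp add: image_point_involution[OF k])
qed

text \<open>
  \<open>S\<close> composed with the fold solves the lattice equation charged on all images: at a point folding to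
  \<open>b\<close>, the steps that leave the strip from \<open>b\<close> contribute \<open>S b\<close> each, which is exactly the difference
  between the degree of \<open>b\<close> and the degree of the lattice.
\<close>

lemma green_images_le_strip:
  fixes y :: "int ^ 'd::finite"
  assumes card: "2 \<le> CARD('d)" and y: "y \<in> strip L i"
  defines "F \<equiv> range (\<lambda>k. image_point L i k y)"
  shows "green_set UNIV F x \<le> green_set (strip L i) {y} (fold_point L i x)"
proof (rule green_set_least)
  let ?S = "green_set (strip L i) {y}"
  fix x :: "int ^ 'd"
  define b where "b = fold_point L i x"
  have b: "b \<in> strip L i"
    by (simp add: b_def fold_point_strip)
  let ?I = "steps_in (strip L i) b"
  obtain k where x: "x = image_point L i k b"
    using image_point_fold_point[of i x] b_def by metis
  have "(\<Sum>e\<in>unit_vecs. ?S (fold_point L i (x + e))) = (\<Sum>e\<in>unit_vecs. ?S (fold_point L i (b + e)))"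
    unfolding x by (subst sum_image_steps) (simp add: fold_point_image_point)
  also have "\<dots> = (\<Sum>e\<in>?I. ?S (fold_point L i (b + e))) +
      of_nat (card (unit_vecs - ?I)) * ?S (fold_point L i b)"
    using step_out_of_strip[OF b] by (intro sum_unit_vecs_split b) (metis fold_point_image_point)
  also have "(\<Sum>e\<in>?I. ?S (fold_point L i (b + e))) = (\<Sum>e\<in>?I. ?S (b + e))"
    by (intro sum.cong) (auto simp: steps_in_def fold_point_ident)
  finally have "indicator F x + (\<Sum>e\<in>unit_vecs. ?S (fold_point L i (x + e))) =
      indicator {y} b + (\<Sum>e\<in>?I. ?S (b + e)) + of_nat (card (unit_vecs - ?I)) * ?S b"
    unfolding F_def indicator_def range_image_point[OF y]
    by (simp add: b_def[symmetric] fold_point_ident[OF b] add.assoc)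
  also have "\<dots> = of_nat (card ?I) * ?S b + of_nat (card (unit_vecs - ?I)) * ?S b"
    by (simp only: green_set_poisson[OF b steps_in_strip_ne[OF card b]])
  also have "\<dots> = of_nat (card (unit_vecs :: (int ^ 'd) set)) * ?S b"
    by (rule card_unit_vecs_split)
  finally show "indicator F x + (\<Sum>e\<in>steps_in UNIV x. ?S (fold_point L i (x + e))) \<le>
      of_nat (card (steps_in UNIV x)) * ?S (fold_point L i x)"
    by (simp add: b_def)
qed simp_all

text \<open>
  By reflection invariance, every step out of the strip contributes one term \<open>H b\<close> to the lattice
  equation at \<open>b\<close>. Finiteness is what allows these terms to be subtracted.
\<close>

lemma green_strip_le_images:
  fixes y :: "int ^ 'd::finite"
  assumes card: "2 \<le> CARD('d)" and y: "y \<in> strip L i"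
  defines "F \<equiv> range (\<lambda>k. image_point L i k y)"
  assumes fin: "\<And>z. z \<in> strip L i \<Longrightarrow> green_set UNIV F z < \<infinity>"
    and x: "x \<in> strip L i"
  shows "green_set (strip L i) {y} x \<le> green_set UNIV F x"
proof (rule green_set_least[OF steps_in_strip_ne[OF card] _ x])
  let ?H = "green_set UNIV F"
  fix b assume b: "b \<in> strip L i"
  let ?I = "steps_in (strip L i) b"
  let ?loops = "of_nat (card (unit_vecs - ?I)) * ?H b"
  have "of_nat (card ?I) * ?H b + ?loops = of_nat (card (unit_vecs :: (int ^ 'd) set)) * ?H b"
    by (rule card_unit_vecs_split)
  also have "\<dots> = indicator F b + (\<Sum>e\<in>unit_vecs. ?H (b + e))"
    using green_set_poisson[of b UNIV F] by simp
  also have "(\<Sum>e\<in>unit_vecs. ?H (b + e)) = (\<Sum>e\<in>?I. ?H (b + e)) + ?loops"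
    using step_out_of_strip[OF b] unfolding F_def
    by (intro sum_unit_vecs_split b) (metis green_images_reflect[OF y])
  also have "indicator F b = (indicator {y} b :: ennreal)"
    unfolding F_def indicator_def range_image_point[OF y] by (simp add: fold_point_ident[OF b])
  finally have "?loops + (indicator {y} b + (\<Sum>e\<in>?I. ?H (b + e))) \<le> ?loops + of_nat (card ?I) * ?H b"
    by (simp only: add.assoc add.commute[of ?loops] order_refl)
  moreover have "?loops \<noteq> \<infinity>"
    using fin[OF b] by (auto simp: ennreal_mult_eq_top_iff)
  ultimately show "indicator {y} b + (\<Sum>e\<in>?I. ?H (b + e)) \<le> of_nat (card ?I) * ?H b"
    unfolding ennreal_add_left_cancel_le by blast
qed

end

section \<open>Transience of the strip\<close>

text \<open>
  The Taylor coefficient of \<open>h\<^sup>2\<close> is \<open>10/64\<close>. Superharmonicity in three unbounded directions tolerates any value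
  below \<open>12/64\<close>, so \<open>11/64\<close> leaves room on both sides.
\<close>

lemma powr_neg_quarter_le:
  fixes h :: real
  assumes "\<bar>h\<bar> \<le> 1 / 100"
  shows "(1 + h) powr (- 1 / 4) \<le> 1 - h / 4 + 11 / 64 * h\<^sup>2"
proof -
  define p where "p = 1 - h / 4 + 11 / 64 * h\<^sup>2"
  define q where "q = 1 - h / 2 + 25 / 64 * h\<^sup>2"
  have h: "- (1 / 100) \<le> h" "h \<le> 1 / 100"
    using assms by (simp_all add: abs_le_iff)
  have p: "0 < p" and q: "0 < q"
    unfolding p_def q_def using h by (auto intro!: add_pos_nonneg)
  \<comment> \<open>\<open>q\<close> bounds the power \<open>-1/2\<close> in the same way, with \<open>25/64\<close> lying between the Taylor coefficient
    \<open>24/64\<close> and the coefficient \<open>26/64\<close> of \<open>h\<^sup>2\<close> in \<open>p\<^sup>2\<close>; so the claim reduces to squaring twice.\<close>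
  have "p\<^sup>2 - q = h\<^sup>2 * (1 / 64 - 11 / 128 * h) + (11 / 64 * h\<^sup>2)\<^sup>2"
    by (simp add: p_def q_def power2_eq_square algebra_simps)
  also have "\<dots> \<ge> 0"
    using h by (intro add_nonneg_nonneg mult_nonneg_nonneg) auto
  finally have "q \<le> p\<^sup>2" by simp
  then have p4: "q\<^sup>2 \<le> p ^ 4"
    using q power_mono[of q "p\<^sup>2" 2] by simp
  have "(1 + h) * q\<^sup>2 - 1 =
      h\<^sup>2 * (1 / 32 + 41 / 64 * h + (25 / 64)\<^sup>2 * h\<^sup>2 - 25 / 64 * h\<^sup>2 + (25 / 64)\<^sup>2 * h ^ 3)"
    by (simp add: q_def power2_eq_square power3_eq_cube field_simps)
  also have "\<dots> \<ge> 0"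
  proof (intro mult_nonneg_nonneg)
    have "h\<^sup>2 \<le> (1 / 100)\<^sup>2"
      using assms by (intro abs_le_square_iff[THEN iffD1]) simp
    moreover have "\<bar>h ^ 3\<bar> \<le> (1 / 100) ^ 3"
      using assms unfolding power_abs by (intro power_mono) auto
    moreover have "0 \<le> h\<^sup>2" by simp
    ultimately show "0 \<le> 1 / 32 + 41 / 64 * h + (25 / 64)\<^sup>2 * h\<^sup>2 - 25 / 64 * h\<^sup>2 + (25 / 64)\<^sup>2 * h ^ 3"
      using h by (simp add: abs_le_iff power2_eq_square[of "25 / 64 :: real"] power3_eq_cube[of "1 / 100 :: real"] power2_eq_square[of "1 / 100 :: real"])
  qed simp
  finally have "1 \<le> (1 + h) * q\<^sup>2" by simp
  also have "\<dots> \<le> (1 + h) * p ^ 4"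
    using p4 h by (intro mult_left_mono) auto
  finally have "1 / (1 + h) \<le> p ^ 4"
    using h by (simp add: field_simps)
  then have "(1 / (1 + h)) powr (1 / 4) \<le> (p ^ 4) powr (1 / 4)"
    using h by (intro powr_mono2) auto
  also have "(p ^ 4) powr (1 / 4) = p"
    using p by (simp only: powr_numeral[symmetric] powr_powr) simp
  also have "(1 / (1 + h)) powr (1 / 4) = (1 + h) powr (- 1 / 4)"
    using h by (simp add: powr_divide powr_minus_divide)
  finally show ?thesis
    unfolding p_def .
qed

definition axial_dist2 :: "'d \<Rightarrow> int ^ 'd::finite \<Rightarrow> int ^ 'd \<Rightarrow> real" where
  "axial_dist2 i y x = (\<Sum>j\<in>UNIV - {i}. (real_of_int (x $ j - y $ j))\<^sup>2)"

lemma axial_dist2_axis_same: "axial_dist2 i y (x + axis i s) = axial_dist2 i y x"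
  unfolding axial_dist2_def by (intro sum.cong) (auto simp: axis_def)

lemma axial_dist2_axis:
  assumes "j \<noteq> i" and "s \<in> {1, -1}"
  shows "axial_dist2 i y (x + axis j s) =
    axial_dist2 i y x + (1 + 2 * real_of_int s * real_of_int (x $ j - y $ j))"
proof -
  have j: "j \<in> UNIV - {i}" using assms by simp
  have rest: "(\<Sum>k\<in>UNIV - {i} - {j}. (real_of_int ((x + axis j s) $ k - y $ k))\<^sup>2) =
      (\<Sum>k\<in>UNIV - {i} - {j}. (real_of_int (x $ k - y $ k))\<^sup>2)"
    by (intro sum.cong) (auto simp: axis_def)
  show ?thesis
    unfolding axial_dist2_def sum.remove[OF _ j, simplified] rest
    using assms(2) by (auto simp: axis_def power2_eq_square algebra_simps)
qed

text \<open>
  In \<open>m\<close> dimensions \<open>(A + r\<^sup>2) powr (- \<alpha>)\<close> is superharmonic for the Laplacian when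
  \<open>\<alpha> \<le> (m - 2)/2\<close>. The choice \<open>\<alpha> = 1/4\<close> is strictly below the critical value \<open>1/2\<close> of \<open>m = 3\<close>, which
  pays for the discretization error once the shift \<open>A\<close> is large; \<open>A = 20000\<close> makes the relative change of
  \<open>A + r\<^sup>2\<close> in one step at most \<open>1/100\<close>.
\<close>

definition lyapunov :: "'d \<Rightarrow> int ^ 'd::finite \<Rightarrow> int ^ 'd \<Rightarrow> real" where
  "lyapunov i y x = (20000 + axial_dist2 i y x) powr (- 1 / 4)"

lemma axial_dist2_nonneg: "0 \<le> axial_dist2 i y x"
  by (simp add: axial_dist2_def sum_nonneg)

lemma lyapunov_axis_le:
  fixes i j :: "'d::finite" and x y :: "int ^ 'd"
  assumes "j \<noteq> i" and s: "s \<in> {1, -1}"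
  defines "S \<equiv> 20000 + axial_dist2 i y x" and "D \<equiv> real_of_int (x $ j - y $ j)"
  shows "lyapunov i y (x + axis j s) \<le>
    lyapunov i y x * (1 - (1 + 2 * real_of_int s * D) / (4 * S) + 11 / 64 * ((1 + 2 * real_of_int s * D) / S)\<^sup>2)"
proof -
  define t where "t = 1 + 2 * real_of_int s * D"
  have S: "20000 \<le> S"
    by (simp add: S_def axial_dist2_nonneg)
  have "D\<^sup>2 \<le> axial_dist2 i y x"
    unfolding axial_dist2_def D_def using \<open>j \<noteq> i\<close>
    by (intro member_le_sum[where f = "\<lambda>j. (real_of_int (x $ j - y $ j))\<^sup>2"]) auto
  then have D: "20000 + D\<^sup>2 \<le> S"
    by (simp add: S_def)
  have "\<bar>t\<bar> \<le> 1 + 2 * \<bar>D\<bar>"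
    using s by (auto simp: t_def)
  \<comment> \<open>\<open>100 (1 + 2 |D|) \<le> 20000 + D\<^sup>2\<close>, by completing the square.\<close>
  moreover have "0 \<le> (\<bar>D\<bar> - 100)\<^sup>2"
    by simp
  then have "0 \<le> D\<^sup>2 - 200 * \<bar>D\<bar> + 10000"
    by (simp add: power2_diff)
  ultimately have "100 * \<bar>t\<bar> \<le> S"
    using D by linarith
  then have "\<bar>t / S\<bar> \<le> 1 / 100"
    using S by (simp add: field_simps)
  note bound = powr_neg_quarter_le[OF this]
  have "lyapunov i y (x + axis j s) = (S + t) powr (- 1 / 4)"
    by (simp add: lyapunov_def axial_dist2_axis[OF assms(1,2)] S_def D_def t_def)
  also have "S + t = S * (1 + t / S)"
    using S by (simp add: field_simps)
  also have "\<dots> powr (- 1 / 4) = S powr (- 1 / 4) * (1 + t / S) powr (- 1 / 4)"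
    using S \<open>\<bar>t / S\<bar> \<le> 1 / 100\<close> by (intro powr_mult)
  also have "\<dots> \<le> S powr (- 1 / 4) * (1 - t / S / 4 + 11 / 64 * (t / S)\<^sup>2)"
    using bound by (intro mult_left_mono) auto
  finally show ?thesis
    by (simp add: lyapunov_def S_def[symmetric] t_def mult.commute)
qed

text \<open>
  Opposite steps cancel the first-order terms in \<open>D\<close>. With \<open>S\<close> the shifted squared distance, what
  remains of the relative change is \<open>(- m/2 + 11/8) / S\<close> up to terms of order \<open>m / S\<^sup>2\<close>, which is
  negative because \<open>m \<ge> 3\<close>.
\<close>

lemma lyapunov_superharmonic:
  fixes i :: "'d::finite"
  assumes "4 \<le> CARD('d)"
  shows "(\<Sum>(j, s)\<in>(UNIV - {i}) \<times> {1, -1}. lyapunov i y (x + axis j s)) \<le>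
    2 * (real CARD('d) - 1) * lyapunov i y x -
      lyapunov i y x / (16 * (20000 + axial_dist2 i y x))"
proof -
  define S where "S = 20000 + axial_dist2 i y x"
  define D where "D j = real_of_int (x $ j - y $ j)" for j
  define m where "m = real CARD('d) - 1"
  have m: "3 \<le> m"
    using assms by (simp add: m_def)
  have card: "real (card (UNIV - {i})) = m"
    using assms by (simp add: m_def card_Diff_subset of_nat_diff)
  have S: "20000 \<le> S"
    by (simp add: S_def axial_dist2_nonneg)
  have sumD: "(\<Sum>j\<in>UNIV - {i}. (D j)\<^sup>2) = S - 20000"
    by (simp add: S_def axial_dist2_def D_def)
  have pair: "lyapunov i y (x + axis j 1) + lyapunov i y (x + axis j (-1)) \<le>
      lyapunov i y x * (2 - 1 / (2 * S) + 11 / 32 / S\<^sup>2 + 11 / 8 / S\<^sup>2 * (D j)\<^sup>2)" if "j \<noteq> i" for j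
  proof -
    have le: "lyapunov i y (x + axis j s) \<le> lyapunov i y x *
        (1 - (1 + 2 * real_of_int s * D j) / (4 * S) + 11 / 64 * ((1 + 2 * real_of_int s * D j) / S)\<^sup>2)"
      if "s \<in> {1, -1}" for s
      using lyapunov_axis_le[OF \<open>j \<noteq> i\<close> that, of y x] by (simp only: S_def D_def)
    have "lyapunov i y (x + axis j 1) + lyapunov i y (x + axis j (-1)) \<le>
        lyapunov i y x * (1 - (1 + 2 * D j) / (4 * S) + 11 / 64 * ((1 + 2 * D j) / S)\<^sup>2) +
        lyapunov i y x * (1 - (1 - 2 * D j) / (4 * S) + 11 / 64 * ((1 - 2 * D j) / S)\<^sup>2)"
      using le[of 1] le[of "-1"] by simp
    also have "\<dots> = lyapunov i y x * (2 - 1 / (2 * S) + 11 / 32 / S\<^sup>2 + 11 / 8 / S\<^sup>2 * (D j)\<^sup>2)"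
      using S by (simp add: field_simps power2_eq_square)
    finally show ?thesis .
  qed
  have "(\<Sum>(j, s)\<in>(UNIV - {i}) \<times> {1, -1}. lyapunov i y (x + axis j s)) =
      (\<Sum>j\<in>UNIV - {i}. lyapunov i y (x + axis j 1) + lyapunov i y (x + axis j (-1)))"
    by (subst sum.cartesian_product[symmetric]) simp
  also have "\<dots> \<le> (\<Sum>j\<in>UNIV - {i}.
      lyapunov i y x * (2 - 1 / (2 * S) + 11 / 32 / S\<^sup>2 + 11 / 8 / S\<^sup>2 * (D j)\<^sup>2))"
    by (intro sum_mono pair) auto
  also have "\<dots> = lyapunov i y x *
      (m * (2 - 1 / (2 * S) + 11 / 32 / S\<^sup>2) + 11 / 8 / S\<^sup>2 * (S - 20000))"
    unfolding sum_distrib_left[symmetric] sum.distrib sumD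
    by (simp only: sum_constant card) (simp add: algebra_simps)
  also have "\<dots> \<le> lyapunov i y x * (2 * m - 1 / (16 * S))"
  proof (intro mult_left_mono)
    let ?l = "m * (2 - 1 / (2 * S) + 11 / 32 / S\<^sup>2) + 11 / 8 / S\<^sup>2 * (S - 20000)"
    have "2 * m - 1 / (16 * S) - ?l = (16 * (m * S) - 46 * S - 11 * m + 880000) / (32 * S\<^sup>2)"
      using S by (simp add: divide_simps) (simp add: power2_eq_square algebra_simps)
    also have "\<dots> \<ge> 0"
    proof -
      have "3 * S \<le> m * S" and "m * 20000 \<le> m * S"
        using m S by (auto intro!: mult_right_mono mult_left_mono)
      then have "0 \<le> 16 * (m * S) - 46 * S - 11 * m + 880000"
        using m by linarith
      then show ?thesis
        by simp
    qed
    finally show "?l \<le> 2 * m - 1 / (16 * S)"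
      by simp
  qed (simp add: lyapunov_def)
  also have "lyapunov i y x * (2 * m - 1 / (16 * S)) = 2 * m * lyapunov i y x - lyapunov i y x / (16 * S)"
    by (simp add: right_diff_distrib)
  finally show ?thesis
    unfolding m_def S_def .
qed

text \<open>
  Steps in the bounded direction do not change the Lyapunov function, so each adds equally to both
  sides and the missing neighbours at the walls are harmless. Dividing by the gain \<open>c\<close> at \<open>y\<close> turns
  the Lyapunov function into a finite supersolution.
\<close>

lemma green_set_strip_finite:
  fixes i :: "'d::finite"
  assumes card: "4 \<le> CARD('d)" and x: "x \<in> strip L i"
  shows "green_set (strip L i) {y} x < \<infinity>"
proof -
  define H :: "(int ^ 'd) set" where "H = (\<lambda>(j, s). axis j s) ` ((UNIV - {i}) \<times> {1, -1})"
  have injH: "inj_on (\<lambda>(j, s). axis j s :: int ^ 'd) ((UNIV - {i}) \<times> {1, -1})"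
    by (rule inj_on_subset[OF inj_on_signed_axis]) auto
  have H: "H \<subseteq> steps_in (strip L i) z" if "z \<in> strip L i" for z
    using that by (auto simp: H_def steps_in_def unit_vecs_def strip_def axis_def image_iff)
  have cardH: "real (card H) = 2 * (real CARD('d) - 1)"
    unfolding H_def using card
    by (subst card_image[OF injH]) (simp add: card_cartesian_product card_Diff_subset of_nat_diff)
  define c where "c = lyapunov i y y / (16 * (20000 + axial_dist2 i y y))"
  have c: "0 < c"
    using axial_dist2_nonneg[of i y y] by (auto simp: c_def lyapunov_def)
  have "green_set (strip L i) {y} x \<le> ennreal (lyapunov i y x / c)"
  proof (rule green_set_least[OF _ _ x])
    fix z assume z: "z \<in> strip L i"
    have "0 < real (card H)"
      using cardH card by simp
    then have "H \<noteq> {}"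
      by auto
    then show "steps_in (strip L i) z \<noteq> {}"
      using H[OF z] by auto
    let ?n = "card (steps_in (strip L i) z)"
    \<comment> \<open>The steps outside \<open>H\<close> are those in the bounded direction.\<close>
    have rest: "lyapunov i y (z + e) = lyapunov i y z" if e: "e \<in> steps_in (strip L i) z - H" for e
    proof -
      obtain s where "e = axis i s"
        using e by (auto simp: steps_in_def unit_vecs_def H_def)
      then show ?thesis
        by (simp add: lyapunov_def axial_dist2_axis_same)
    qed
    have "(\<Sum>e\<in>steps_in (strip L i) z. lyapunov i y (z + e)) =
        (\<Sum>e\<in>H. lyapunov i y (z + e)) + (\<Sum>e\<in>steps_in (strip L i) z - H. lyapunov i y (z + e))"
      using H[OF z] by (subst sum.subset_diff[of H]) auto
    also have "(\<Sum>e\<in>steps_in (strip L i) z - H. lyapunov i y (z + e)) =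
        (real ?n - real (card H)) * lyapunov i y z"
      using H[OF z] by (simp add: rest card_Diff_subset finite_subset[OF H[OF z]] of_nat_diff card_mono)
    also have "(\<Sum>e\<in>H. lyapunov i y (z + e)) =
        (\<Sum>(j, s)\<in>(UNIV - {i}) \<times> {1, -1}. lyapunov i y (z + axis j s))"
      unfolding H_def by (subst sum.reindex[OF injH]) (simp add: case_prod_unfold)
    also have "\<dots> \<le> real (card H) * lyapunov i y z - lyapunov i y z / (16 * (20000 + axial_dist2 i y z))"
      using lyapunov_superharmonic[OF card] by (simp add: cardH)
    also have "\<dots> \<le> real (card H) * lyapunov i y z - c * indicator {y} z"
      using axial_dist2_nonneg[of i y z] by (auto simp: c_def lyapunov_def split: split_indicator)
    finally have *: "c * indicator {y} z + (\<Sum>e\<in>steps_in (strip L i) z. lyapunov i y (z + e)) \<le>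
        real ?n * lyapunov i y z"
      by (simp add: algebra_simps)
    have nn: "0 \<le> lyapunov i y v" for v
      by (simp add: lyapunov_def)
    have "indicator {y} z + (\<Sum>e\<in>steps_in (strip L i) z. ennreal (lyapunov i y (z + e) / c)) =
        ennreal ((c * indicator {y} z + (\<Sum>e\<in>steps_in (strip L i) z. lyapunov i y (z + e))) / c)"
      using c nn by (subst sum_ennreal)
        (auto simp: add_divide_distrib sum_divide_distrib ennreal_plus sum_nonneg ennreal_indicator[symmetric]
          simp del: ennreal_indicator)
    also have "\<dots> \<le> ennreal (real ?n * lyapunov i y z / c)"
      using * c by (intro ennreal_leI divide_right_mono) auto
    also have "\<dots> = of_nat ?n * ennreal (lyapunov i y z / c)"
      using c nn by (simp add: ennreal_mult'[symmetric] ennreal_of_nat_eq_real_of_nat)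
    finally show "indicator {y} z + (\<Sum>e\<in>steps_in (strip L i) z. ennreal (lyapunov i y (z + e) / c)) \<le>
        of_nat ?n * ennreal (lyapunov i y z / c)" .
  qed
  then show ?thesis
    by (rule order_le_less_trans) simp
qed

section \<open>The Green's function of the strip\<close>

theorem proposition5:
  fixes L :: nat and i :: "'d::finite" and x y :: "int ^ 'd"
  assumes "CARD('d) \<ge> 4" and "L \<ge> 2"
    and "x \<in> strip L i" and "y \<in> strip L i"
  shows "strip_green L i x y < \<infinity> \<and>
    strip_green L i x y =
      (\<Sum>\<^sub>\<infinity>k::int.
          lattice_green x ((k * int L + int L - 1) *s axis i 1 + reflect i y) * indicator {k. odd k} k
        + lattice_green x ((k * int L) *s axis i 1 + y) * indicator {k. even k} k)"
proof -
  let ?S = "green_set (strip L i) {y}"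
  let ?H = "green_set UNIV (range (\<lambda>k. image_point L i k y))"
  have L: "0 < L" and card: "2 \<le> CARD('d)"
    using assms(1,2) by simp_all
  note y = assms(4)
  have S: "strip_green L i x y = ?S x"
    by (simp add: strip_green_def green_eq_green_set)
  have finS: "?S z < \<infinity>" if "z \<in> strip L i" for z
    by (rule green_set_strip_finite[OF assms(1) that])
  have HS: "?H z \<le> ?S z" if "z \<in> strip L i" for z
    using green_images_le_strip[OF L card y, of z] by (simp add: fold_point_ident[OF L that])
  have "?S x = ?H x"
    using green_strip_le_images[OF L card y order_le_less_trans[OF HS finS] assms(3)] HS[OF assms(3)]
    by (simp add: antisym)
  also have "?H x = (\<Sum>\<^sub>\<infinity>k. lattice_green x (image_point L i k y))"
    by (rule green_set_UNIV_range[OF inj_image_point[OF L y], symmetric])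
  also have "\<dots> = (\<Sum>\<^sub>\<infinity>k::int.
          lattice_green x ((k * int L + int L - 1) *s axis i 1 + reflect i y) * indicator {k. odd k} k
        + lattice_green x ((k * int L) *s axis i 1 + y) * indicator {k. even k} k)"
    by (intro infsum_cong) (simp add: image_point_def)
  finally show ?thesis
    using S finS[OF assms(3)] by simp
qed

end
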